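(* There are no trinomials $x^5+Ax^2+B$ with $A,B\in\mathbb{Q}$, $AB\neq0$, having reducibility type $(1,2,2)$ or $(1,1,1,2)$.
   Context: A monic polynomial in $\mathbb{Q}[x]$ has reducibility type $(n_1,\dots,n_k)$, $n_1\le\dots\le n_k$, if it factors as a product of $k$ irreducible polynomials in $\mathbb{Q}[x]$ (not necessarily distinct) of degrees $n_1,\dots,n_k$. *)

theory Defs
  imports "HOL-Computational_Algebra.Computational_Algebra"
begin

text \<open>The factors \<open>qs\<close> may repeat and are not required to be monic: they can be rescaled freely
  by nonzero constants, since the product is monic.\<close>

definition has_reducibility_type :: "rat poly \<Rightarrow> nat list \<Rightarrow> bool" where
  "has_reducibility_type p ns \<longleftrightarrow>
     lead_coeff p = 1 \<and> sorted ns \<and>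
     (\<exists>qs. (\<forall>q \<in> set qs. irreducible q) \<and> map degree qs = ns \<and> p = prod_list qs)"

end

theory Submission imports Defs begin

text \<open>Let \<open>(x - r) (x\<^sup>2 + a x + b) (x\<^sup>2 + c x + d)\<close> be the factorization. Comparing coefficients and eliminating
  \<open>c\<close> and \<open>d\<close> leaves a quadratic equation for \<open>b\<close>, whose discriminant must be a square; this gives a
  rational point with \<open>x = 2a - r\<close>, \<open>z = r\<close> on the genus one curve
  \<open>y\<^sup>2 = (x\<^sup>2 - z\<^sup>2) (x\<^sup>2 + 15 z\<^sup>2)\<close>. The points with \<open>x\<^sup>2 = z\<^sup>2\<close> force \<open>B = 0\<close>. For any
  other point, in coprime integers, the two factors have a gcd dividing 16, so up to a common factor 1 or 2
  both are squares. The factor 2 is impossible modulo 8, and the factor 1 makes both \<open>m\<^sup>2 + q\<^sup>2\<close> and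
  \<open>m\<^sup>2 + 16 q\<^sup>2\<close> squares with \<open>m q \<noteq> 0\<close>, which is excluded by infinite descent.\<close>

section \<open>Squares, residues and coprime factorizations of integers\<close>

lemma coprime_mult_eq_square_int:
  fixes x y z :: int
  assumes "coprime x y" "x \<ge> 0" "y \<ge> 0" "x * y = z\<^sup>2"
  obtains u v where "u \<ge> 0" "v \<ge> 0" "x = u\<^sup>2" "y = v\<^sup>2"
proof -
  have "int (nat x * nat y) = int ((nat \<bar>z\<bar>)\<^sup>2)"
    using assms by simp
  hence "nat x * nat y = (nat \<bar>z\<bar>)\<^sup>2"
    by (simp only: of_nat_eq_iff)
  hence "is_nth_power 2 (nat x * nat y)"
    by (auto simp: is_nth_power_def)
  moreover have "coprime (nat x) (nat y)"
    using assms by (simp add: coprime_int_iff [symmetric])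
  ultimately have "is_nth_power 2 (nat x)" "is_nth_power 2 (nat y)"
    by (simp_all add: is_nth_power_mult_coprime_nat_iff)
  then obtain u v where "nat x = u\<^sup>2" "nat y = v\<^sup>2"
    by (auto simp: is_nth_power_def)
  hence "x = (int u)\<^sup>2" "y = (int v)\<^sup>2"
    using assms by (metis int_nat_eq of_nat_power)+
  thus ?thesis using that by (metis of_nat_0_le_iff)
qed

lemma odd_square_mod_8: "odd x \<Longrightarrow> x\<^sup>2 mod 8 = (1::int)"
proof -
  assume "odd x"
  then obtain k where k: "x = 2 * k + 1" by (elim oddE)
  obtain j where j: "k * (k + 1) = 2 * j" by (metis dvdE even_mult_iff odd_one odd_even_add)
  have "x\<^sup>2 = 4 * (k * (k + 1)) + 1" unfolding k by (simp add: power2_eq_square algebra_simps)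
  thus ?thesis unfolding j by simp
qed

lemma even_square_mod_4: "even x \<Longrightarrow> x\<^sup>2 mod 4 = (0::int)"
  by (auto simp: power2_eq_square elim!: evenE)

lemma odd_square_mod_4: "odd x \<Longrightarrow> x\<^sup>2 mod 4 = (1::int)"
  using odd_square_mod_8[of x] by presburger

lemma coprime_four_odd_int: "odd x \<Longrightarrow> coprime 4 (x::int)"
  using coprime_power_left_iff[of 2 2 x] by simp

lemma three_dvd_sum_squares:
  fixes x y :: int
  assumes "3 dvd x\<^sup>2 + y\<^sup>2"
  shows "3 dvd x \<and> 3 dvd y"
proof -
  have sq: "z\<^sup>2 mod 3 = (if 3 dvd z then 0 else 1)" for z :: int
  proof -
    have "z mod 3 = 0 \<or> z mod 3 = 1 \<or> z mod 3 = 2" by presburger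
    hence "(z mod 3)\<^sup>2 mod 3 = (if z mod 3 = 0 then 0 else 1)"
      by (elim disjE) simp_all
    thus ?thesis by (simp only: power_mod dvd_eq_mod_eq_0)
  qed
  have "(x\<^sup>2 mod 3 + y\<^sup>2 mod 3) mod 3 = 0"
    using assms by (simp add: mod_simps)
  thus ?thesis unfolding sq by (auto split: if_splits)
qed

text \<open>Take \<open>a = gcd u r\<close>: the cofactors \<open>b\<close> and \<open>c\<close> are
  coprime, and cancelling \<open>a\<close> leaves \<open>b * v = c * s\<close>, so \<open>c\<close>
  divides \<open>v\<close>.\<close>

lemma four_numbers_int:
  fixes u v r s :: int
  assumes "u * v = r * s" "r \<noteq> 0"
  obtains a b c d where "u = a * b" "v = c * d" "r = a * c" "s = b * d" "coprime b c"
proof -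
  have g: "gcd u r \<noteq> 0" using assms(2) by simp
  then obtain b c where bc: "u = b * gcd u r" "r = c * gcd u r" "coprime b c"
    using gcd_coprime_exists by blast
  have "b * v = c * s"
    using assms(1) bc(1,2) g by (metis mult.assoc mult.commute mult_left_cancel)
  hence "c dvd b * v" by simp
  moreover have "coprime c b" using bc(3) by (simp add: coprime_commute)
  ultimately have "c dvd v" by (simp only: coprime_dvd_mult_right_iff)
  then obtain d where d: "v = c * d" by blast
  have "c \<noteq> 0" using bc(2) assms(2) by auto
  hence "s = b * d" using \<open>b * v = c * s\<close> d by simp
  thus ?thesis using that[of "gcd u r" b c d] bc d by (simp add: mult.commute)
qed

section \<open>Pythagorean triples and the infinite descent\<close>

text \<open>The halves of \<open>\<bar>p\<bar> + m\<close> and \<open>\<bar>p\<bar> - m\<close> are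
  coprime with product \<open>(q div 2)^2\<close>, hence both squares. The residue of
  \<open>m\<close> modulo 4 decides which of the two roots is odd.\<close>

lemma pythagorean_parametrization:
  fixes m q p :: int
  assumes "coprime m q" "even q" "m mod 4 = 1" "m\<^sup>2 + q\<^sup>2 = p\<^sup>2"
  obtains u v where "u \<ge> 0" "v \<ge> 0" "m = u\<^sup>2 - v\<^sup>2" "\<bar>q\<bar> = 2 * u * v" "coprime u v" "odd u" "even v"
proof -
  have "odd m" using assms(3) by presburger
  have "odd (p\<^sup>2)" using assms(2) \<open>odd m\<close> by (simp add: assms(4)[symmetric])
  hence "odd p" by simp
  obtain k where k: "q = 2 * k" using assms(2) by blast
  define x where "x = (\<bar>p\<bar> + m) div 2"
  define y where "y = (\<bar>p\<bar> - m) div 2"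
  have x: "2 * x = \<bar>p\<bar> + m" unfolding x_def using \<open>odd p\<close> \<open>odd m\<close> by auto
  have y: "2 * y = \<bar>p\<bar> - m" unfolding y_def using \<open>odd p\<close> \<open>odd m\<close> by auto
  have "(2 * x) * (2 * y) = p\<^sup>2 - m\<^sup>2"
    unfolding x y by (simp add: algebra_simps power2_eq_square)
  hence xy: "x * y = k\<^sup>2" using assms(4) k by (simp add: power2_eq_square)
  have m: "m = x - y" using x y by simp
  have "coprime x y"
  proof (rule coprimeI)
    fix c assume c: "c dvd x" "c dvd y"
    hence "c\<^sup>2 dvd k\<^sup>2" using mult_dvd_mono[OF c] xy by (simp add: power2_eq_square)
    hence "c dvd q" using k by simp
    moreover have "c dvd m" using c m by simp
    ultimately show "is_unit c" using assms(1) coprime_common_divisor by blast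
  qed
  moreover have "m\<^sup>2 \<le> p\<^sup>2" using assms(4) by (metis le_add_same_cancel1 zero_le_power2)
  hence "\<bar>m\<bar> \<le> \<bar>p\<bar>" by (simp add: abs_le_square_iff)
  hence "x \<ge> 0" "y \<ge> 0" using x y by linarith+
  ultimately obtain u v where uv: "u \<ge> 0" "v \<ge> 0" "x = u\<^sup>2" "y = v\<^sup>2"
    using coprime_mult_eq_square_int xy by metis
  have "k\<^sup>2 = (u * v)\<^sup>2" using xy uv by (simp add: power_mult_distrib)
  hence "\<bar>k\<bar> = u * v" using uv by (metis abs_of_nonneg mult_nonneg_nonneg power2_eq_iff abs_minus_cancel)
  hence q: "\<bar>q\<bar> = 2 * u * v" using k by simp
  have muv: "m = u\<^sup>2 - v\<^sup>2" using m uv by simp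
  have "odd u \<and> even v"
    using assms(3) muv even_square_mod_4[of u] odd_square_mod_4[of u]
      even_square_mod_4[of v] odd_square_mod_4[of v]
    by (cases "even u"; cases "even v"; simp; presburger)
  moreover have "coprime u v" using \<open>coprime x y\<close> uv by simp
  ultimately show ?thesis using that uv muv q by blast
qed

text \<open>As \<open>b\<close> and \<open>c\<close> are coprime, the two sums are
  \<open>b^2 * g\<close> and \<open>c^2 * g\<close> with a common \<open>g\<close>, a divisor of 15.
  The prime 3 is excluded because -1 is not a square modulo 3, and \<open>g = 5\<close> because it
  would give 5 = 1 modulo 8.\<close>

lemma concordant_descent:
  fixes a b c d :: int
  assumes eq: "b\<^sup>2 * (a\<^sup>2 + 16 * d\<^sup>2) = c\<^sup>2 * (a\<^sup>2 + d\<^sup>2)"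
    and "coprime a d" "coprime b c" "odd a" "odd c" "b \<noteq> 0"
  shows "a\<^sup>2 + d\<^sup>2 = b\<^sup>2 \<and> a\<^sup>2 + 16 * d\<^sup>2 = c\<^sup>2"
proof -
  have "b\<^sup>2 dvd c\<^sup>2 * (a\<^sup>2 + d\<^sup>2)" by (metis eq dvd_triv_left)
  moreover have "coprime (b\<^sup>2) (c\<^sup>2)" using assms by simp
  ultimately have "b\<^sup>2 dvd a\<^sup>2 + d\<^sup>2" by (simp add: coprime_dvd_mult_right_iff)
  then obtain g where g: "a\<^sup>2 + d\<^sup>2 = b\<^sup>2 * g" by blast
  hence g': "a\<^sup>2 + 16 * d\<^sup>2 = c\<^sup>2 * g" 
  proof -
    have "b\<^sup>2 * (a\<^sup>2 + 16 * d\<^sup>2) = b\<^sup>2 * (c\<^sup>2 * g)" unfolding eq g by (simp add: ac_simps)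
    thus ?thesis using \<open>b \<noteq> 0\<close> by simp
  qed
  have "a \<noteq> 0" using \<open>odd a\<close> by auto
  hence "0 < a\<^sup>2 + d\<^sup>2" by (simp add: sum_power2_gt_zero_iff)
  hence "g > 0" using g by (simp add: zero_less_mult_iff)
  \<comment> \<open>The first combination eliminates \<open>a^2\<close>, the second
    \<open>d^2\<close>; coprimality of \<open>a\<close> and \<open>d\<close> then yields
    \<open>g dvd 15\<close>.\<close>
  have "15 * d\<^sup>2 = g * (c\<^sup>2 - b\<^sup>2)" "15 * a\<^sup>2 = g * (16 * b\<^sup>2 - c\<^sup>2)"
    using g g' by (simp_all add: algebra_simps)
  hence "g dvd 15 * d\<^sup>2" "g dvd 15 * a\<^sup>2" by (metis dvd_triv_left)+
  hence "g dvd gcd (15 * a\<^sup>2) (15 * d\<^sup>2)" by simp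
  moreover have "gcd (15 * a\<^sup>2) (15 * d\<^sup>2) = 15"
    using \<open>coprime a d\<close> by (simp add: gcd_mult_left coprime_imp_gcd_eq_1)
  ultimately have "g dvd 3 * 5" by simp
  have "\<not> 3 dvd g"
  proof
    assume "3 dvd g"
    hence "3 dvd a\<^sup>2 + d\<^sup>2" using g by simp
    hence "is_unit (3::int)" using three_dvd_sum_squares \<open>coprime a d\<close> coprime_common_divisor by blast
    thus False by simp
  qed
  hence "coprime g 3" using prime_imp_coprime[of 3 g] by (simp add: coprime_commute)
  with \<open>g dvd 3 * 5\<close> have "g dvd 5" by (simp only: coprime_dvd_mult_right_iff)
  hence "g = 1 \<or> g = 5" using \<open>g > 0\<close> prime_int_iff[of 5] by simp
  moreover have "g \<noteq> 5"
  proof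
    assume "g = 5"
    hence "5 * c\<^sup>2 = a\<^sup>2 + 16 * d\<^sup>2" using g' by simp
    thus False using odd_square_mod_8[OF \<open>odd a\<close>] odd_square_mod_8[OF \<open>odd c\<close>] by presburger
  qed
  ultimately have "g = 1" by blast
  thus ?thesis using g g' by simp
qed

text \<open>Both \<open>(m, q, p)\<close> and \<open>(m, 4 * q, n)\<close> are Pythagorean triples.
  Comparing their parametrizations produces a solution with \<open>d\<close> in place of
  \<open>q\<close>, where \<open>d\<close> is even, nonzero and divides \<open>v\<close>, so that
  \<open>\<bar>d\<bar> \<le> v < 2 * u * v = \<bar>q\<bar>\<close>.\<close>

lemma concordant_1_16_even:
  fixes m q p n :: int
  assumes "coprime m q" "even q" "m\<^sup>2 + q\<^sup>2 = p\<^sup>2" "m\<^sup>2 + 16 * q\<^sup>2 = n\<^sup>2"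
  shows "q = 0"
  using assms
proof (induction "nat \<bar>q\<bar>" arbitrary: m q p n rule: less_induct)
  case less
  show ?case
  proof (rule ccontr)
    assume "q \<noteq> 0"
    have "odd m" using less.prems(1,2) by (auto simp: coprime_def)
    \<comment> \<open>Fixing the sign of \<open>m\<close> ensures that both Pythagorean triples below give
      \<open>m\<close> as an odd minus an even square.\<close>
    define m' where "m' = (if m mod 4 = 1 then m else - m)"
    have m': "m' mod 4 = 1" "m'\<^sup>2 = m\<^sup>2" "coprime m' q"
      using \<open>odd m\<close> less.prems(1) unfolding m'_def by (auto; presburger)+
    obtain u v where uv: "u \<ge> 0" "v \<ge> 0" "m' = u\<^sup>2 - v\<^sup>2" "\<bar>q\<bar> = 2 * u * v" "coprime u v" "odd u" "even v"
      using pythagorean_parametrization[of m' q p] m' less.prems by metis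
    have "odd m'" using m'(1) by presburger
    hence "coprime m' 4" using coprime_four_odd_int by (simp add: coprime_commute)
    hence "coprime m' (4 * q)" using m'(3) by simp
    moreover have "m'\<^sup>2 + (4 * q)\<^sup>2 = n\<^sup>2" using less.prems m' by (simp add: power_mult_distrib)
    moreover have "even (4 * q)" by simp
    ultimately obtain r s where rs: "r \<ge> 0" "s \<ge> 0" "m' = r\<^sup>2 - s\<^sup>2" "\<bar>4 * q\<bar> = 2 * r * s" "odd r" "even s"
      using pythagorean_parametrization[OF _ _ m'(1)] by blast
    have rsuv: "r * s = 4 * (u * v)" using uv(4) rs(4) by (simp add: abs_mult)
    have "4 dvd s"
    proof -
      have "coprime 4 r" using rs(5) by (rule coprime_four_odd_int)
      moreover have "4 dvd r * s" unfolding rsuv by (rule dvd_triv_left)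
      ultimately show ?thesis by (simp only: coprime_dvd_mult_right_iff)
    qed
    then obtain t where t: "s = 4 * t" by blast
    have "u * v = r * t" using rsuv t by simp
    moreover have "r \<noteq> 0" using rs by auto
    ultimately obtain a b c d where abcd: "u = a * b" "v = c * d" "r = a * c" "t = b * d" "coprime b c"
      using four_numbers_int[of u v r t] by blast
    \<comment> \<open>Equate the two expressions for \<open>m'\<close>; substituting the four-number
      factorization separates the variables into the shape needed for
      \<open>concordant_descent\<close>.\<close>
    have "u\<^sup>2 + s\<^sup>2 = r\<^sup>2 + v\<^sup>2" using uv(3) rs(3) by simp
    hence "b\<^sup>2 * (a\<^sup>2 + 16 * d\<^sup>2) = c\<^sup>2 * (a\<^sup>2 + d\<^sup>2)"
      unfolding t abcd by (simp add: power_mult_distrib algebra_simps)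
    moreover have ad: "coprime a d" using uv(5) abcd by simp
    moreover have "odd a" "odd c" "b \<noteq> 0" using uv(6) rs(5) abcd by auto
    ultimately have new: "a\<^sup>2 + d\<^sup>2 = b\<^sup>2" "a\<^sup>2 + 16 * d\<^sup>2 = c\<^sup>2"
      using concordant_descent abcd(5) by blast+
    have "even d" using uv(7) \<open>odd c\<close> abcd by simp
    have "v \<noteq> 0" using \<open>q \<noteq> 0\<close> uv(4) by auto
    hence "d \<noteq> 0" using abcd by auto
    have "\<bar>d\<bar> \<le> v" using \<open>v \<noteq> 0\<close> uv(2) abcd(2) dvd_imp_le_int[of v d] by simp
    also have "v < 2 * (u * v)"
    proof -
      have "u \<noteq> 0" using uv by auto
      hence "1 * v \<le> u * v" using uv(1,2) by (intro mult_right_mono) auto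
      thus ?thesis using \<open>v \<noteq> 0\<close> uv(2) by linarith
    qed
    finally have "\<bar>d\<bar> < \<bar>q\<bar>" using uv(4) by simp
    hence "d = 0" using less.hyps[OF _ ad \<open>even d\<close> new] by simp
    with \<open>d \<noteq> 0\<close> show False by simp
  qed
qed

text \<open>If \<open>q\<close> is odd, then \<open>m = 4 * m2\<close>, and dividing the second
  equation by 16 exchanges the roles of the two equations: \<open>(q, m2)\<close> is a solution
  whose second entry is even.\<close>

lemma concordant_1_16:
  fixes m q p n :: int
  assumes "coprime m q" "m\<^sup>2 + q\<^sup>2 = p\<^sup>2" "m\<^sup>2 + 16 * q\<^sup>2 = n\<^sup>2"
  shows "m = 0 \<or> q = 0"
proof (cases "even q")
  case True
  thus ?thesis using concordant_1_16_even assms by blast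
next
  case False
  note sq = even_square_mod_4 odd_square_mod_4
  have "even m"
    using sq[of m] sq(1,2)[of p] sq(2)[OF False] assms(2) by presburger
  then obtain m1 where m1: "m = 2 * m1" by blast
  have "even (n\<^sup>2)" using \<open>even m\<close> by (simp add: assms(3)[symmetric])
  hence "even n" by simp
  then obtain n1 where n1: "n = 2 * n1" by blast
  have e1: "m1\<^sup>2 + 4 * q\<^sup>2 = n1\<^sup>2" using assms(3) m1 n1 by simp
  have "even m1"
  proof (rule ccontr)
    assume o: "odd m1"
    hence "odd (n1\<^sup>2)" using e1 by (metis even_add even_mult_iff even_numeral even_power)
    hence "odd n1" by simp
    \<comment> \<open>With all three numbers odd, \<open>e1\<close> reads 1 + 4 = 1 modulo
      8.\<close>
    thus False using e1 odd_square_mod_8[OF o] odd_square_mod_8[of n1] odd_square_mod_8[OF False] by presburger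
  qed
  then obtain m2 where m2: "m1 = 2 * m2" by blast
  have "even (n1\<^sup>2)" using \<open>even m1\<close> by (simp add: e1[symmetric])
  hence "even n1" by simp
  then obtain n2 where n2: "n1 = 2 * n2" by blast
  have e2: "q\<^sup>2 + m2\<^sup>2 = n2\<^sup>2" using e1 m2 n2 by simp
  have "even m2"
    using sq[of m2] sq(1,2)[of n2] sq(2)[OF False] e2 by presburger
  moreover have "q\<^sup>2 + 16 * m2\<^sup>2 = p\<^sup>2" using assms(2) m1 m2 by simp
  moreover have "coprime q m2" using assms(1) m1 m2 by (simp add: coprime_commute)
  ultimately have "m2 = 0" using concordant_1_16_even e2 by blast
  thus ?thesis using m1 m2 by simp
qed

section \<open>Rational points on the genus one curve\<close>

lemma quartic_int_square:
  fixes p q w :: int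
  assumes "coprime p q" "q \<noteq> 0" and eq: "(p\<^sup>2 - q\<^sup>2) * (p\<^sup>2 + 15 * q\<^sup>2) = w\<^sup>2"
  shows "p\<^sup>2 = q\<^sup>2"
proof (rule ccontr)
  assume ne: "p\<^sup>2 \<noteq> q\<^sup>2"
  have "0 < q\<^sup>2" using \<open>q \<noteq> 0\<close> by simp
  hence pos: "0 < p\<^sup>2 + 15 * q\<^sup>2" using zero_le_power2[of p] by linarith
  moreover have "0 \<le> (p\<^sup>2 - q\<^sup>2) * (p\<^sup>2 + 15 * q\<^sup>2)" unfolding eq by simp
  ultimately have pos': "0 < p\<^sup>2 - q\<^sup>2" using ne by (simp add: zero_le_mult_iff)
  define g where "g = gcd (p\<^sup>2 - q\<^sup>2) (p\<^sup>2 + 15 * q\<^sup>2)"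
  have "g \<noteq> 0" using pos by (simp add: g_def)
  hence "g > 0" using gcd_ge_0_int[of "p\<^sup>2 - q\<^sup>2"] unfolding g_def by (simp add: order_less_le)
  obtain X Y where XY: "p\<^sup>2 - q\<^sup>2 = X * g" "p\<^sup>2 + 15 * q\<^sup>2 = Y * g" "coprime X Y"
    using gcd_coprime_exists[of "p\<^sup>2 - q\<^sup>2" "p\<^sup>2 + 15 * q\<^sup>2"] \<open>g \<noteq> 0\<close> unfolding g_def by blast
  have "g\<^sup>2 * (X * Y) = w\<^sup>2" using eq unfolding XY by (simp add: power2_eq_square ac_simps)
  moreover from this have "g\<^sup>2 dvd w\<^sup>2" by (metis dvd_triv_left)
  then obtain k where "w = g * k" by (metis dvdE dvd_power_iff zero_neq_numeral pow_divides_pow_iff zero_less_numeral)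
  ultimately have "X * Y = k\<^sup>2" using \<open>g \<noteq> 0\<close> by (simp add: power_mult_distrib)
  moreover have "0 \<le> X" "0 \<le> Y" using pos pos' \<open>g > 0\<close> unfolding XY by (simp_all add: zero_less_mult_iff)
  ultimately obtain x y where xy: "X = x\<^sup>2" "Y = y\<^sup>2"
    using coprime_mult_eq_square_int \<open>coprime X Y\<close> by metis
  have "g dvd 16 * q\<^sup>2" "g dvd 16 * p\<^sup>2"
  proof -
    have "16 * q\<^sup>2 = (Y - X) * g" "16 * p\<^sup>2 = (15 * X + Y) * g"
      using XY(1,2) by (simp_all add: algebra_simps)
    thus "g dvd 16 * q\<^sup>2" "g dvd 16 * p\<^sup>2" by (metis dvd_triv_right)+
  qed
  hence "g dvd gcd (16 * p\<^sup>2) (16 * q\<^sup>2)" by simp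
  moreover have "gcd (16 * p\<^sup>2) (16 * q\<^sup>2) = 16"
    using \<open>coprime p q\<close> by (simp add: gcd_mult_left coprime_imp_gcd_eq_1)
  ultimately have "g dvd 2 ^ 4" by simp
  then obtain i where "i \<le> 4" "normalize g = normalize (2 ^ i)"
    using divides_primepow[of 2 g 4] by auto
  hence "g = 2 ^ i" using \<open>g > 0\<close> by simp
  moreover have "i \<in> {0, 1, 2, 3, 4}" using \<open>i \<le> 4\<close> by auto
  \<comment> \<open>Only the parity of the exponent \<open>i\<close> matters; the witnesses 1, 2, 4
    are the powers of 2 with exponent \<open>i div 2\<close>.\<close>
  ultimately have "\<exists>j. g = j\<^sup>2 \<or> g = 2 * j\<^sup>2"
    by (auto intro: exI[of _ 1] exI[of _ 2] exI[of _ 4])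
  then obtain j where "g = j\<^sup>2 \<or> g = 2 * j\<^sup>2" by blast
  then obtain m n where "(p\<^sup>2 - q\<^sup>2 = m\<^sup>2 \<and> p\<^sup>2 + 15 * q\<^sup>2 = n\<^sup>2) \<or>
      (p\<^sup>2 - q\<^sup>2 = 2 * m\<^sup>2 \<and> p\<^sup>2 + 15 * q\<^sup>2 = 2 * n\<^sup>2)"
    using that[of "x * j" "y * j"] XY(1,2) xy by (auto simp: power_mult_distrib)
  thus False
  proof (elim disjE conjE)
    assume mn: "p\<^sup>2 - q\<^sup>2 = m\<^sup>2" "p\<^sup>2 + 15 * q\<^sup>2 = n\<^sup>2"
    have p: "m\<^sup>2 + q\<^sup>2 = p\<^sup>2" and n: "m\<^sup>2 + 16 * q\<^sup>2 = n\<^sup>2" using mn by simp_all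
    have "coprime (m\<^sup>2) q"
    proof -
      have "coprime (p\<^sup>2) q" using \<open>coprime p q\<close> by simp
      moreover have "p\<^sup>2 = m\<^sup>2 + q * q" using p by (simp add: power2_eq_square)
      ultimately show ?thesis by (metis coprime_iff_gcd_eq_1 gcd.commute gcd_add_mult add.commute)
    qed
    hence "m = 0 \<or> q = 0" using concordant_1_16 p n by simp
    thus False using mn pos' \<open>q \<noteq> 0\<close> by auto
  next
    assume mn: "p\<^sup>2 - q\<^sup>2 = 2 * m\<^sup>2" "p\<^sup>2 + 15 * q\<^sup>2 = 2 * n\<^sup>2"
    have "even (p\<^sup>2 - q\<^sup>2)" unfolding mn by simp
    hence "odd p" "odd q" using \<open>coprime p q\<close> by (auto simp: coprime_def)
    note odd = odd_square_mod_8[OF \<open>odd p\<close>] odd_square_mod_8[OF \<open>odd q\<close>]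
    \<comment> \<open>Both left-hand sides in \<open>mn\<close> vanish modulo 8, so \<open>m\<close>
      and \<open>n\<close> are even. Halving them leaves a difference of two squares congruent to 2
      modulo 4, which is impossible.\<close>
    have "even m" using mn(1) odd odd_square_mod_4[of m] by presburger
    moreover have "even n" using mn odd \<open>even m\<close> even_square_mod_4[of m] odd_square_mod_4[of n] by presburger
    ultimately obtain m1 n1 where "m = 2 * m1" "n = 2 * n1" by blast
    hence "n1\<^sup>2 - m1\<^sup>2 = 2 * q\<^sup>2" using mn by simp
    moreover have "m1\<^sup>2 mod 4 \<in> {0, 1}" "n1\<^sup>2 mod 4 \<in> {0, 1}"
      using even_square_mod_4 odd_square_mod_4 by blast+
    ultimately show False using odd(2) unfolding insert_iff empty_iff by presburger
  qed
qed

lemma int_square_of_rat: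
  fixes w :: rat
  assumes "w\<^sup>2 = of_int n"
  obtains k where "n = k\<^sup>2"
proof -
  obtain a b where ab: "b > 0" "coprime a b" "w = of_int a / of_int b"
    by (metis Fract_of_int_quotient Rat_cases)
  have "(of_int (a\<^sup>2) :: rat) = of_int (b\<^sup>2 * n)"
    using assms ab(1) unfolding ab(3) by (simp add: field_simps)
  hence e: "a\<^sup>2 = b\<^sup>2 * n" by (simp only: of_int_eq_iff)
  hence "b\<^sup>2 dvd a\<^sup>2" by simp
  hence "b dvd a" by simp
  hence "is_unit b" using ab(2) by (metis coprime_common_divisor dvd_refl)
  hence "b = 1" using ab(1) by simp
  thus ?thesis using that[of a] e by simp
qed

lemma quartic_rat_square:
  fixes x z y :: rat
  assumes "z \<noteq> 0" and eq: "(x\<^sup>2 - z\<^sup>2) * (x\<^sup>2 + 15 * z\<^sup>2) = y\<^sup>2"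
  shows "x\<^sup>2 = z\<^sup>2"
proof -
  obtain p q where pq: "q > 0" "coprime p q" "x / z = of_int p / of_int q"
    by (metis Fract_of_int_quotient Rat_cases)
  have x: "x = of_int p / of_int q * z" using pq(3) \<open>z \<noteq> 0\<close> by (metis nonzero_divide_eq_eq)
  \<comment> \<open>The equation is homogeneous of degree 4 in \<open>x\<close> and
    \<open>z\<close>, so replacing \<open>(x, z)\<close> by \<open>(p, q)\<close> scales
    \<open>y\<close> by \<open>(q / z)^2\<close>.\<close>
  define w where "w = y / z\<^sup>2 * of_int (q\<^sup>2)"
  have "w\<^sup>2 = of_int ((p\<^sup>2 - q\<^sup>2) * (p\<^sup>2 + 15 * q\<^sup>2))"
    unfolding w_def power_mult_distrib power_divide eq[symmetric] unfolding x
    using pq(1) \<open>z \<noteq> 0\<close> by (simp add: field_simps power2_eq_square)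
  then obtain k where "(p\<^sup>2 - q\<^sup>2) * (p\<^sup>2 + 15 * q\<^sup>2) = k\<^sup>2" by (rule int_square_of_rat)
  hence "p\<^sup>2 = q\<^sup>2" using quartic_int_square pq by simp
  hence "(of_int p :: rat)\<^sup>2 = (of_int q)\<^sup>2" by (metis of_int_power)
  thus ?thesis unfolding x using pq(1) by (simp add: power_mult_distrib power_divide)
qed

section \<open>From factorizations of the trinomial to points on the curve\<close>

text \<open>Only degrees are prescribed, so a quadratic factor may itself be a product of two linear
  ones; this lets both reducibility types be treated at once.\<close>

lemma trinomial_not_linear_times_quadratics:
  fixes A B :: rat and f g h :: "rat poly"
  assumes "degree f = 1" "degree g = 2" "degree h = 2" "B \<noteq> 0"
  shows "monom 1 5 + monom A 2 + [:B:] \<noteq> f * g * h"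
proof
  assume eq: "monom 1 5 + monom A 2 + [:B:] = f * g * h"
  obtain f0 f1 where f: "f = [:f0, f1:]" "f1 \<noteq> 0"
    using assms(1) degree1_coeffs by blast
  obtain g0 g1 g2 where g: "g = [:g0, g1, g2:]" "g2 \<noteq> 0"
    using assms(2) degree2_coeffs by blast
  obtain h0 h1 h2 where h: "h = [:h0, h1, h2:]" "h2 \<noteq> 0"
    using assms(3) degree2_coeffs by blast
  define r a b c d where "r = - f0 / f1" "a = g1 / g2" "b = g0 / g2" "c = h1 / h2" "d = h0 / h2"
  have fgh: "f0 = - r * f1" "g1 = a * g2" "g0 = b * g2" "h1 = c * h2" "h0 = d * h2"
    using f g h by (simp_all add: r_a_b_c_d_def)
  have co: "coeff (monom 1 5 + monom A 2 + [:B:]) i = coeff (f * g * h) i" for i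
    by (simp only: eq)
  have "f1 * g2 * h2 = 1"
    using co[of 5] unfolding f g h by (simp add: eval_nat_numeral ac_simps)
  \<comment> \<open>The leading coefficients multiply to 1, so the factors can be replaced by monic
    ones.\<close>
  have "smult (f1 * g2 * h2) ([:-r, 1:] * [:b, a, 1:] * [:d, c, 1:]) = f * g * h"
    unfolding f g h fgh by (simp add: algebra_simps)
  hence co: "coeff (monom 1 5 + monom A 2 + [:B:]) i = coeff ([:-r, 1:] * [:b, a, 1:] * [:d, c, 1:]) i" for i
    by (simp only: eq[symmetric] \<open>f1 * g2 * h2 = 1\<close> smult_1_left)
  have e4: "c = r - a"
    using co[of 4] by (simp add: eval_nat_numeral)
  have e3: "d = r\<^sup>2 - b - a * c"
    using co[of 3] unfolding e4 by (simp add: eval_nat_numeral algebra_simps)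
  have e1: "b * d = r * (a * d + b * c)"
    using co[of 1] by (simp add: eval_nat_numeral algebra_simps)
  have e0: "r * b * d = - B"
    using co[of 0] by (simp add: algebra_simps)
  have "r \<noteq> 0" "b \<noteq> 0" "d \<noteq> 0" using e0 \<open>B \<noteq> 0\<close> by auto
  have "b\<^sup>2 - (a\<^sup>2 + a * r) * b + r * a ^ 3 - r\<^sup>2 * a\<^sup>2 + r ^ 3 * a = 0"
    using e1 unfolding e3 e4 by algebra
  \<comment> \<open>Completing the square in \<open>b\<close> gives \<open>(2 * b - a^2 - a * r)^2 =
    a * (a - r) * (a^2 - a * r + 4 * r^2)\<close>. In terms of \<open>2 * a - r\<close>, the factors
    \<open>4 * a * (a - r)\<close> and \<open>4 * (a^2 - a * r + 4 * r^2)\<close> lose their linear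
    terms.\<close>
  hence quartic: "((2 * a - r)\<^sup>2 - r\<^sup>2) * ((2 * a - r)\<^sup>2 + 15 * r\<^sup>2) = (4 * (2 * b - a\<^sup>2 - a * r))\<^sup>2"
    by algebra
  hence sq: "(2 * a - r)\<^sup>2 = r\<^sup>2" using quartic_rat_square \<open>r \<noteq> 0\<close> by blast
  hence y: "2 * b = a\<^sup>2 + a * r" using quartic by simp
  have "a * (a - r) = 0" using sq by algebra
  hence "a = 0 \<or> a = r" by simp
  \<comment> \<open>The first case makes \<open>b\<close> vanish, the second \<open>d\<close>;
    either contradicts \<open>B \<noteq> 0\<close>.\<close>
  thus False
  proof
    assume "a = 0"
    thus False using y \<open>b \<noteq> 0\<close> by simp
  next
    assume "a = r"
    hence "b = r\<^sup>2" "c = 0" using y e4 by (simp_all add: power2_eq_square)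
    thus False using e3 \<open>d \<noteq> 0\<close> by simp
  qed
qed

theorem theorem3p2:
  fixes A B :: rat
  assumes "A * B \<noteq> 0"
  shows "\<not> has_reducibility_type (monom 1 5 + monom A 2 + [:B:]) [1, 2, 2] \<and>
         \<not> has_reducibility_type (monom 1 5 + monom A 2 + [:B:]) [1, 1, 1, 2]"
proof -
  have "B \<noteq> 0" using assms by simp
  note no = trinomial_not_linear_times_quadratics[OF _ _ _ this]
  have "monom 1 5 + monom A 2 + [:B:] \<noteq> prod_list qs" if deg: "map degree qs = [1, 2, 2]" for qs
  proof -
    obtain f g h where "qs = [f, g, h]" "degree f = 1" "degree g = 2" "degree h = 2"
      using deg by (auto simp: map_eq_Cons_conv)
    thus ?thesis using no[of f g h A] by (simp add: mult.assoc)
  qed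
  moreover have "monom 1 5 + monom A 2 + [:B:] \<noteq> prod_list qs" if deg: "map degree qs = [1, 1, 1, 2]" for qs
  proof -
    obtain f g h k where qs: "qs = [f, g, h, k]" "degree f = 1" "degree g = 1" "degree h = 1" "degree k = 2"
      using deg by (auto simp: map_eq_Cons_conv)
    hence "degree (g * h) = 2" by (subst degree_mult_eq) auto
    thus ?thesis using no[of f "g * h" k A] qs by (simp add: mult.assoc)
  qed
  ultimately show ?thesis unfolding has_reducibility_type_def by metis
qed

end
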